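(* For every $\varepsilon>0$ there exists a sequence of bipartite graphs $G_1,G_2,\dots$ such that the probability that MinGreedy, run on $G_n$, returns a matching of size at most $(\tfrac12+\varepsilon)\,\nu(G_n)$ tends to $1$ as $n\to\infty$. In other words, MinGreedy does not achieve approximation ratio $\tfrac12+\varepsilon$ with high probability, even on bipartite graphs.
   Context: For a finite simple graph $G$, $\nu(G)$ denotes the size of a maximum matching. MinGreedy (Tinhofer's minimum-degree randomized greedy algorithm) works as follows: start with $M=\emptyset$ and the current graph equal to $G$; while the current graph has an edge, choose a node $u$ uniformly at random among all non-isolated nodes of minimum degree in the current graph, choose a neighbor $v$ of $u$ in the current graph uniformly at random, add $\{u,v\}$ to $M$, and delete $u$, $v$ and all their incident edges from the current graph. Output $M$. *)

theory Defs
  imports "HOL-Probability.Probability"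
begin

type_synonym 'a graph = "'a set \<times> 'a set set"

abbreviation verts :: "'a graph \<Rightarrow> 'a set" where "verts \<equiv> fst"
abbreviation edges :: "'a graph \<Rightarrow> 'a set set" where "edges \<equiv> snd"

definition simple_graph :: "'a graph \<Rightarrow> bool" where
  "simple_graph G \<longleftrightarrow> finite (verts G) \<and> (\<forall>e\<in>edges G. e \<subseteq> verts G \<and> card e = 2)"

definition bipartite :: "'a graph \<Rightarrow> bool" where
  "bipartite G \<longleftrightarrow> (\<exists>A B. A \<union> B = verts G \<and> A \<inter> B = {} \<and>
     (\<forall>e\<in>edges G. \<exists>a\<in>A. \<exists>b\<in>B. e = {a, b}))"

definition matching :: "'a graph \<Rightarrow> 'a set set \<Rightarrow> bool" where
  "matching G M \<longleftrightarrow> M \<subseteq> edges G \<and> disjoint M"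

definition matching_number :: "'a graph \<Rightarrow> nat" where
  "matching_number G = Max (card ` {M. matching G M})"

definition neighbors :: "'a graph \<Rightarrow> 'a \<Rightarrow> 'a set" where
  "neighbors G u = {v. {u, v} \<in> edges G}"

definition degree :: "'a graph \<Rightarrow> 'a \<Rightarrow> nat" where
  "degree G u = card (neighbors G u)"

definition min_degree_nodes :: "'a graph \<Rightarrow> 'a set" where
  "min_degree_nodes G = {u \<in> verts G. degree G u > 0 \<and>
     (\<forall>w\<in>verts G. degree G w > 0 \<longrightarrow> degree G u \<le> degree G w)}"

definition delete_nodes :: "'a graph \<Rightarrow> 'a set \<Rightarrow> 'a graph" where
  "delete_nodes G U = (verts G - U, {e \<in> edges G. e \<inter> U = {}})"

lemma simple_graph_finite_edges:
  assumes "simple_graph G"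
  shows "finite (edges G)"
  using assms by (intro finite_subset[of "edges G" "Pow (verts G)"]) (auto simp: simple_graph_def)

lemma neighbors_subset_verts:
  assumes "simple_graph G"
  shows "neighbors G u \<subseteq> verts G"
  using assms by (auto simp: simple_graph_def neighbors_def)

lemma finite_neighbors:
  assumes "simple_graph G"
  shows "finite (neighbors G u)"
  using neighbors_subset_verts[OF assms] assms
  by (auto simp: simple_graph_def intro: finite_subset)

lemma degree_pos_iff:
  assumes "simple_graph G"
  shows "degree G u > 0 \<longleftrightarrow> neighbors G u \<noteq> {}"
  using finite_neighbors[OF assms] by (simp add: degree_def card_gt_0_iff)

lemma finite_min_degree_nodes:
  assumes "simple_graph G"
  shows "finite (min_degree_nodes G)"
  using assms by (auto simp: simple_graph_def min_degree_nodes_def)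

lemma min_degree_nodes_nonempty:
  assumes "simple_graph G" "edges G \<noteq> {}"
  shows "min_degree_nodes G \<noteq> {}"
proof -
  obtain e where e: "e \<in> edges G" using assms(2) by blast
  then obtain x y where xy: "e = {x, y}" "x \<in> verts G"
    using assms(1) by (auto simp: simple_graph_def card_2_iff)
  then have "degree G x > 0"
    using e by (auto simp: degree_pos_iff[OF assms(1)] neighbors_def)
  then obtain u where "u \<in> verts G \<and> degree G u > 0"
      "\<forall>w. w \<in> verts G \<and> degree G w > 0 \<longrightarrow> degree G u \<le> degree G w"
    using ex_has_least_nat[of "\<lambda>u. u \<in> verts G \<and> degree G u > 0" x "degree G"] xy(2)
    by blast
  then show ?thesis by (auto simp: min_degree_nodes_def)
qed

lemma simple_graph_delete_nodes:
  assumes "simple_graph G"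
  shows "simple_graph (delete_nodes G U)"
  using assms by (auto simp: simple_graph_def delete_nodes_def)

text \<open>The result is the distribution of the matching returned by MinGreedy.  The test
  \<^term>\<open>simple_graph G\<close> only makes the recursion total; it is preserved by
  \<^const>\<open>delete_nodes\<close>, so it never cuts short a run that starts in a finite
  simple graph.\<close>

function min_greedy :: "'a graph \<Rightarrow> 'a set set pmf" where
  "min_greedy G =
     (if simple_graph G \<and> edges G \<noteq> {} then
        bind_pmf (pmf_of_set (min_degree_nodes G)) (\<lambda>u.
        bind_pmf (pmf_of_set (neighbors G u)) (\<lambda>v.
        bind_pmf (min_greedy (delete_nodes G {u, v})) (\<lambda>M.
        return_pmf (insert {u, v} M))))
      else return_pmf {})"
  by pat_completeness auto
termination
proof (relation "Wellfounded.measure (\<lambda>G. card (edges G))", goal_cases)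
  case 1
  show ?case by simp
next
  case (2 G u v)
  then have G: "simple_graph G" "edges G \<noteq> {}" by auto
  have "u \<in> min_degree_nodes G"
    using 2(2) G by (simp add: finite_min_degree_nodes min_degree_nodes_nonempty)
  then have "neighbors G u \<noteq> {}"
    using degree_pos_iff[OF G(1), of u] by (simp add: min_degree_nodes_def)
  then have "v \<in> neighbors G u"
    using 2(3) finite_neighbors[OF G(1)] by simp
  then have "{u, v} \<in> edges G" by (simp add: neighbors_def)
  moreover have "{u, v} \<notin> edges (delete_nodes G {u, v})"
    by (simp add: delete_nodes_def)
  moreover have "edges (delete_nodes G {u, v}) \<subseteq> edges G"
    unfolding delete_nodes_def snd_conv by blast
  ultimately have "edges (delete_nodes G {u, v}) \<subset> edges G"
    by blast
  then show ?case
    using simple_graph_finite_edges[OF G(1)] by (simp add: psubset_card_mono)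
qed

declare min_greedy.simps [simp del]

end

theory Submission
  imports Defs "HOL-Real_Asymp.Real_Asymp"
begin

text \<open>
  The hard graph has \<open>n\<close> disjoint blocks, each a complete bipartite graph with \<open>n\<close> nodes per side;
  every block node \<open>x\<close> has a private mate outside the blocks, and the edges from block nodes to
  their mates form a matching of size \<open>2 * n * n\<close>.  A hub \<open>W\<close> with \<open>n + 2\<close> nodes per side,
  joined completely to itself and to the mates on the opposite side, makes every degree outside
  the blocks at least \<open>n + 2\<close>, whereas block nodes have degree at most \<open>n + 1\<close>.  So, until the
  blocks are used up, MinGreedy always picks a block node \<open>u\<close>; if \<open>l\<close> neighbours of \<open>u\<close> are left in
  its block, then \<open>u\<close> is joined to its mate with probability only \<open>1 / (l + 1)\<close> and otherwise two
  block nodes are spent on one edge.  A potential argument bounds the expected number of mate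
  edges by \<open>2 * ln (n + 1)\<close> per block, and once the blocks are gone the hub is a vertex cover, so
  that at most \<open>card W\<close> further edges are chosen.  Markov's inequality finishes the proof.
\<close>

section \<open>MinGreedy and vertex covers\<close>

lemma card_insert_le_Suc: "card (insert x A) \<le> Suc (card A)"
  by (cases "finite A") (auto simp: card_insert_if)

lemma min_greedy_rec:
  assumes "simple_graph G" "edges G \<noteq> {}"
  shows "min_greedy G =
    bind_pmf (pmf_of_set (min_degree_nodes G)) (\<lambda>u.
    bind_pmf (pmf_of_set (neighbors G u)) (\<lambda>v.
    map_pmf (insert {u, v}) (min_greedy (delete_nodes G {u, v}))))"
  using assms by (subst min_greedy.simps) (simp add: map_pmf_def)

text \<open>Each chosen edge uses up a cover node: \<open>W - {u, v}\<close> is strictly smaller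
  than \<open>W\<close> and still covers what is left. The induction therefore generalises over
  \<open>W\<close> too.\<close>

lemma card_min_greedy_le_vertex_cover:
  assumes "finite W" "\<And>e. e \<in> edges G \<Longrightarrow> e \<inter> W \<noteq> {}" "M \<in> set_pmf (min_greedy G)"
  shows "card M \<le> card W"
  using assms
proof (induction "card (edges G)" arbitrary: G W M rule: less_induct)
  case less
  show ?case
  proof (cases "simple_graph G \<and> edges G \<noteq> {}")
    case False
    then have "min_greedy G = return_pmf {}"
      by (subst min_greedy.simps) auto
    then show ?thesis using less.prems by simp
  next
    case True
    then have G: "simple_graph G" "edges G \<noteq> {}" by auto
    from less.prems(3) obtain u v M' where
      u: "u \<in> min_degree_nodes G" and v: "v \<in> set_pmf (pmf_of_set (neighbors G u))" and
      M': "M' \<in> set_pmf (min_greedy (delete_nodes G {u, v}))" and M: "M = insert {u, v} M'"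
      by (auto simp: min_greedy_rec[OF G] finite_min_degree_nodes[OF G(1)] min_degree_nodes_nonempty[OF G])
    from u have "neighbors G u \<noteq> {}"
      using degree_pos_iff[OF G(1)] by (auto simp: min_degree_nodes_def)
    with v have "v \<in> neighbors G u" using finite_neighbors[OF G(1)] by simp
    then have e: "{u, v} \<in> edges G" by (simp add: neighbors_def)
    have "edges (delete_nodes G {u, v}) \<subseteq> edges G"
      unfolding delete_nodes_def snd_conv by blast
    moreover have "{u, v} \<notin> edges (delete_nodes G {u, v})"
      by (simp add: delete_nodes_def)
    ultimately have "edges (delete_nodes G {u, v}) \<subset> edges G"
      using e by blast
    then have "card (edges (delete_nodes G {u, v})) < card (edges G)"
      using simple_graph_finite_edges[OF G(1)] by (rule psubset_card_mono[rotated])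
    then have "card M' \<le> card (W - {u, v})"
    proof (rule less.hyps)
      show "finite (W - {u, v})" using less.prems(1) by simp
      fix e assume "e \<in> edges (delete_nodes G {u, v})"
      then have "e \<in> edges G" "e \<inter> {u, v} = {}" by (simp_all add: delete_nodes_def)
      then show "e \<inter> (W - {u, v}) \<noteq> {}" using less.prems(2) by blast
    qed (rule M')
    moreover have "card (W - {u, v}) < card W"
      using less.prems(1) less.prems(2)[OF e] by (intro psubset_card_mono) auto
    ultimately show ?thesis
      using card_insert_le_Suc[of "{u, v}" M'] unfolding M by linarith
  qed
qed

section \<open>Graphs given by an adjacency relation\<close>

definition graph_on :: "('a \<Rightarrow> 'a \<Rightarrow> bool) \<Rightarrow> 'a set \<Rightarrow> 'a graph" where
  "graph_on adj S = (S, {{x, y} | x y. x \<in> S \<and> y \<in> S \<and> adj x y})"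

lemma verts_graph_on [simp]: "verts (graph_on adj S) = S"
  by (simp add: graph_on_def)

text \<open>Every graph in a run is determined by its surviving nodes, so node sets can serve as the
  states of the algorithm.\<close>

lemma delete_nodes_graph_on: "delete_nodes (graph_on adj S) U = graph_on adj (S - U)"
  by (auto simp: delete_nodes_def graph_on_def)

lemma neighbors_graph_on:
  assumes "symp adj"
  shows "neighbors (graph_on adj S) x = {y \<in> S. x \<in> S \<and> adj x y}"
  using assms by (auto simp: neighbors_def graph_on_def doubleton_eq_iff dest: sympD)

section \<open>The potential of a single block\<close>

text \<open>
  Bounds the expected number of future mate edges in a block with \<open>k\<close> and \<open>l\<close> nodes left on its two
  sides: the \<open>\<bar>k - l\<bar>\<close> surplus nodes can only go to their mates, and for \<open>k \<le> l\<close> a mate edge at the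
  smaller side costs itself plus one more surplus node, with probability \<open>1 / (l + 1) \<le> ln (k + 1) - ln k\<close>.
\<close>

definition block_potential :: "nat \<Rightarrow> nat \<Rightarrow> real" where
  "block_potential k l = \<bar>real k - real l\<bar> + 2 * ln (real (min k l) + 1)"

lemma block_potential_commute: "block_potential k l = block_potential l k"
  by (simp add: block_potential_def min.commute abs_minus_commute)

lemma block_potential_nonneg: "block_potential k l \<ge> 0"
  by (simp add: block_potential_def)

text \<open>This is \<open>ln t \<le> t - 1\<close> at \<open>t = k / (k + 1)\<close>.\<close>

lemma ln_add_one_ge:
  assumes "k > 0"
  shows "1 / (real k + 1) + ln (real k) \<le> ln (real k + 1)"
proof -
  have "ln (real k / (real k + 1)) \<le> real k / (real k + 1) - 1"
    using assms by (intro ln_le_minus_one) simp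
  also have "\<dots> = - (1 / (real k + 1))" by (simp add: field_simps)
  finally show ?thesis using assms by (simp add: ln_div)
qed

text \<open>The drift inequality, multiplied by the number \<open>l + 1\<close> of neighbours of a
  node on the side of size \<open>k\<close>: one choice is the mate, which costs 1 and leaves
  \<open>(k - 1, l)\<close>; the other \<open>l\<close> choices leave \<open>(k - 1, l - 1)\<close>.
  At \<open>l = 0\<close> the truncated \<open>l - 1\<close> is annihilated by the factor
  \<open>real l\<close>.\<close>

lemma block_potential_step:
  assumes "k > 0"
  shows "1 + block_potential (k - 1) l + real l * block_potential (k - 1) (l - 1)
    \<le> (real l + 1) * block_potential k l"
proof -
  obtain k' where k: "k = Suc k'" using assms by (cases k) auto
  show ?thesis
  proof (cases l)
    case 0
    then show ?thesis by (simp add: k block_potential_def)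
  next
    case l: (Suc l')
    show ?thesis
    proof (cases "l < k")
      case True
      \<comment> \<open>On the larger side, a mate edge pays for itself by lowering the surplus by
        1, so monotonicity of \<open>ln\<close> suffices.\<close>
      have "ln (real l) \<le> ln (real l + 1)" using l by simp
      then have "real l * ln (real l) \<le> real l * ln (real l + 1)"
        by (intro mult_left_mono) auto
      moreover have "min (k - 1) l = l" "min (k - 1) (l - 1) = l - 1" "min k l = l"
        "\<bar>real (k - 1) - real l\<bar> = real k - real l - 1"
        "\<bar>real (k - 1) - real (l - 1)\<bar> = real k - real l" "\<bar>real k - real l\<bar> = real k - real l"
        "real (l - 1) + 1 = real l"
        using True by (auto simp: k l)
      ultimately show ?thesis
        unfolding block_potential_def by (simp only:) (simp add: algebra_simps)
    next
      case False
      \<comment> \<open>Otherwise a mate edge costs 1 and raises the surplus by 1. These 2 units are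
        paid by twice the drop from \<open>ln (k + 1)\<close> to \<open>ln k\<close>, which occurs
        for all \<open>l + 1\<close> choices.\<close>
      have "1 / (real l + 1) \<le> 1 / (real k + 1)"
        using False by (intro divide_left_mono) auto
      then have "1 / (real l + 1) + ln (real k) \<le> ln (real k + 1)"
        using ln_add_one_ge[OF assms] by linarith
      then have "(real l + 1) * (1 / (real l + 1) + ln (real k)) \<le> (real l + 1) * ln (real k + 1)"
        by (intro mult_left_mono) auto
      then have "1 + (real l + 1) * ln (real k) \<le> (real l + 1) * ln (real k + 1)"
        by (simp add: distrib_left)
      moreover have "min (k - 1) l = k - 1" "min (k - 1) (l - 1) = k - 1" "min k l = k"
        "\<bar>real (k - 1) - real l\<bar> = real l - real k + 1"
        "\<bar>real (k - 1) - real (l - 1)\<bar> = real l - real k" "\<bar>real k - real l\<bar> = real l - real k"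
        "real (k - 1) + 1 = real k"
        using False by (auto simp: k l)
      ultimately show ?thesis
        unfolding block_potential_def by (simp only:) (simp add: algebra_simps)
    qed
  qed
qed

section \<open>The hard graph: block nodes \<open>X\<close>, hub \<open>W\<close>, blocks indexed by
  \<open>B\<close>\<close>

locale block_graph =
  fixes X W :: "'a set" and B :: "'b set" and blk :: "'a \<Rightarrow> 'b"
    and side :: "'a \<Rightarrow> bool" and mate :: "'a \<Rightarrow> 'a" and m :: nat
  assumes finite_X: "finite X" and finite_W: "finite W" and finite_B: "finite B"
    and inj_mate: "inj_on mate X"
    and side_mate: "\<And>x. x \<in> X \<Longrightarrow> side (mate x) \<noteq> side x"
    and X_mate: "X \<inter> mate ` X = {}" and W_X: "W \<inter> X = {}" and W_mate: "W \<inter> mate ` X = {}"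
    and blk_in_B: "blk ` X \<subseteq> B"
    and card_block: "\<And>b s. b \<in> B \<Longrightarrow> card {x \<in> X. blk x = b \<and> side x = s} = m"
    and card_W_side: "\<And>s. card {w \<in> W. side w = s} = m + 2"
begin

definition V where "V = X \<union> mate ` X \<union> W"

text \<open>The disjuncts are block edges, mate edges and hub edges, the last two in both
  orientations. Two mates are never adjacent, so every edge without a hub node has an endpoint in
  \<open>X\<close>.\<close>

definition adj where
  "adj x y \<longleftrightarrow> side x \<noteq> side y \<and>
     (x \<in> X \<and> y \<in> X \<and> blk x = blk y \<or> x \<in> X \<and> y = mate x \<or> y \<in> X \<and> x = mate y \<or>
      x \<in> W \<and> y \<in> W \<union> mate ` X \<or> y \<in> W \<and> x \<in> W \<union> mate ` X)"

definition graph where "graph = graph_on adj"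

lemma symp_adj: "symp adj"
  by (rule sympI) (auto simp: adj_def)

lemma finite_V: "finite V"
  by (simp add: V_def finite_X finite_W)

lemma simple_graph_graph: "S \<subseteq> V \<Longrightarrow> simple_graph (graph S)"
  using finite_subset[OF _ finite_V]
  by (auto simp: simple_graph_def graph_def graph_on_def adj_def card_insert_if)

lemma bipartite_graph: "bipartite (graph S)"
  unfolding bipartite_def
proof (intro exI conjI ballI)
  show "{x \<in> S. side x} \<union> {x \<in> S. \<not> side x} = verts (graph S)"
    by (auto simp: graph_def)
  fix e assume "e \<in> edges (graph S)"
  then obtain x y where e: "e = {x, y}" "x \<in> S" "y \<in> S" "side x \<noteq> side y"
    by (auto simp: graph_def graph_on_def adj_def)
  then show "\<exists>a\<in>{x \<in> S. side x}. \<exists>b\<in>{x \<in> S. \<not> side x}. e = {a, b}"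
    by (cases "side x") (auto simp: insert_commute)
qed auto

section \<open>Degrees in reachable states\<close>

definition opposite where
  "opposite S x = {y \<in> X \<inter> S. blk y = blk x \<and> side y \<noteq> side x}"

text \<open>The states reachable while block nodes remain: no hub node and no mate of a remaining
  block node has been deleted.\<close>

definition intact where
  "intact S \<longleftrightarrow> S \<subseteq> V \<and> W \<subseteq> S \<and> (\<forall>x\<in>X \<inter> S. mate x \<in> S)"

lemma X_subset_V: "X \<subseteq> V"
  by (auto simp: V_def)

lemma intact_V: "intact V"
  by (auto simp: intact_def V_def)

lemma neighbors_X:
  assumes "intact S" "x \<in> X \<inter> S"
  shows "neighbors (graph S) x = insert (mate x) (opposite S x)"
  using assms X_mate W_X side_mate[of x]
  unfolding graph_def neighbors_graph_on[OF symp_adj] opposite_def intact_def adj_def by auto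

lemma mate_notin_opposite: "x \<in> X \<Longrightarrow> mate x \<notin> opposite S x"
  using X_mate by (auto simp: opposite_def)

lemma finite_opposite: "finite (opposite S x)"
  by (simp add: opposite_def finite_X)

lemma degree_X:
  assumes "intact S" "x \<in> X \<inter> S"
  shows "degree (graph S) x = Suc (card (opposite S x))"
  using assms mate_notin_opposite[of x S] finite_opposite[of S x]
  by (simp add: degree_def neighbors_X)

lemma degree_X_le:
  assumes "intact S" "x \<in> X \<inter> S"
  shows "degree (graph S) x \<le> m + 1"
proof -
  have "card (opposite S x) \<le> card {y \<in> X. blk y = blk x \<and> side y = (\<not> side x)}"
    using finite_X by (intro card_mono) (auto simp: opposite_def)
  also have "\<dots> = m" using assms(2) blk_in_B by (intro card_block) auto
  finally show ?thesis using degree_X[OF assms] by simp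
qed

text \<open>Mates and hub nodes alike are joined to all hub nodes of the opposite side, and an
  intact state has lost none of these.\<close>

lemma degree_other_ge:
  assumes "intact S" "x \<in> S - X"
  shows "degree (graph S) x \<ge> m + 2"
proof -
  have "m + 2 = card {w \<in> W. side w = (\<not> side x)}" by (simp add: card_W_side)
  also have "\<dots> \<le> degree (graph S) x"
    unfolding degree_def using assms finite_subset[OF _ finite_V, of S]
    by (intro card_mono)
       (auto simp: graph_def neighbors_graph_on[OF symp_adj] adj_def intact_def V_def)
  finally show ?thesis .
qed

text \<open>The gap between degree at most \<open>m + 1\<close> inside \<open>X\<close> and at least
  \<open>m + 2\<close> outside decides; this is why the hub has \<open>m + 2\<close> nodes per
  side.\<close>

lemma min_degree_nodes_in_X:
  assumes "intact S" "X \<inter> S \<noteq> {}"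
  shows "min_degree_nodes (graph S) \<subseteq> X \<inter> S"
proof
  fix u assume u: "u \<in> min_degree_nodes (graph S)"
  from assms obtain x where x: "x \<in> X \<inter> S" by blast
  have "degree (graph S) u \<le> degree (graph S) x"
    using u x degree_X[OF assms(1) x] by (auto simp: min_degree_nodes_def graph_def)
  also have "\<dots> \<le> m + 1" by (rule degree_X_le[OF assms(1) x])
  finally show "u \<in> X \<inter> S"
    using degree_other_ge[OF assms(1), of u] u by (auto simp: min_degree_nodes_def graph_def)
qed

section \<open>The potential of a state and its drift\<close>

definition cnt where "cnt S b s = card {x \<in> X \<inter> S. blk x = b \<and> side x = s}"

definition potential where
  "potential S = (\<Sum>b\<in>B. block_potential (cnt S b True) (cnt S b False))"

lemma potential_nonneg: "potential S \<ge> 0"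
  unfolding potential_def by (intro sum_nonneg block_potential_nonneg)

lemma potential_V: "potential V = real (card B) * (2 * ln (real m + 1))"
proof -
  have "X \<inter> V = X" by (auto simp: V_def)
  then show ?thesis
    by (simp add: potential_def cnt_def card_block[of _ True, simplified]
        card_block[of _ False, simplified] block_potential_def)
qed

text \<open>Isolates one block with a chosen side first, so that the drift inequality applies
  whichever side the selected node is on.\<close>

lemma potential_split:
  assumes "b \<in> B"
  shows "potential S = block_potential (cnt S b s) (cnt S b (\<not> s)) +
    (\<Sum>b'\<in>B - {b}. block_potential (cnt S b' True) (cnt S b' False))"
  unfolding potential_def sum.remove[OF finite_B assms]
  by (cases s) (simp_all add: block_potential_commute)

lemma cnt_remove:
  assumes "x \<in> X \<inter> S"
  shows "cnt (S - {x}) b s = cnt S b s - (if b = blk x \<and> s = side x then 1 else 0)"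
proof (cases "b = blk x \<and> s = side x")
  case True
  then have "{y \<in> X \<inter> (S - {x}). blk y = b \<and> side y = s} = {y \<in> X \<inter> S. blk y = b \<and> side y = s} - {x}"
    by auto
  then show ?thesis using True assms finite_X by (simp add: cnt_def)
next
  case False
  then have "{y \<in> X \<inter> (S - {x}). blk y = b \<and> side y = s} = {y \<in> X \<inter> S. blk y = b \<and> side y = s}"
    by auto
  then show ?thesis using False by (auto simp: cnt_def)
qed

lemma cnt_remove_other:
  assumes "x \<notin> X"
  shows "cnt (S - {x}) b s = cnt S b s"
proof -
  have "{y \<in> X \<inter> (S - {x}). blk y = b \<and> side y = s} = {y \<in> X \<inter> S. blk y = b \<and> side y = s}"
    using assms by auto
  then show ?thesis by (simp add: cnt_def)
qed

lemma card_opposite: "card (opposite S x) = cnt S (blk x) (\<not> side x)"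
  unfolding opposite_def cnt_def by (rule arg_cong[where f = card]) auto

text \<open>Only the block of \<open>x\<close> changes; the other blocks contribute the same
  \<open>r\<close> to every term. All partners inside the block leave the same counts, hence a
  common value \<open>p\<close>.\<close>

lemma potential_step:
  assumes x: "x \<in> X \<inter> S" and l: "l = card (opposite S x)"
  obtains p where "1 + potential (S - {x, mate x}) + real l * p \<le> (real l + 1) * potential S"
    and "\<And>y. y \<in> opposite S x \<Longrightarrow> potential (S - {x, y}) = p"
proof -
  define b s where "b = blk x" and "s = side x"
  define k where "k = cnt S b s"
  define r where "r = (\<Sum>b'\<in>B - {b}. block_potential (cnt S b' True) (cnt S b' False))"
  have b: "b \<in> B" using x blk_in_B by (auto simp: b_def)
  have l': "l = cnt S b (\<not> s)" by (simp add: l card_opposite b_def s_def)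
  have "x \<in> {y \<in> X \<inter> S. blk y = b \<and> side y = s}" using x by (auto simp: b_def s_def)
  then have "k > 0" unfolding k_def cnt_def using finite_X by (auto simp: card_gt_0_iff)
  have S: "potential S = block_potential k l + r"
    by (simp add: potential_split[OF b, of _ s] k_def l' r_def)
  have mx: "mate x \<notin> X" using X_mate x by auto
  have mate: "S - {x, mate x} = S - {x} - {mate x}" by auto
  have S1: "potential (S - {x, mate x}) = block_potential (k - 1) l + r"
    unfolding potential_split[OF b, of _ s] mate cnt_remove_other[OF mx] cnt_remove[OF x]
    by (simp add: b_def[symmetric] s_def[symmetric] k_def l' r_def)
  have S2: "potential (S - {x, y}) = block_potential (k - 1) (l - 1) + r" if "y \<in> opposite S x" for y
  proof -
    have y: "y \<in> X \<inter> (S - {x})" "blk y = b" "side y \<noteq> s"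
      using that by (auto simp: opposite_def b_def s_def)
    have "S - {x, y} = S - {x} - {y}" by auto
    then show ?thesis
      unfolding potential_split[OF b, of _ s] using y
      by (simp add: cnt_remove[OF y(1)] cnt_remove[OF x] b_def[symmetric] s_def[symmetric] k_def l' r_def)
  qed
  show ?thesis
  proof (rule that[OF _ S2])
    show "1 + potential (S - {x, mate x}) + real l * (block_potential (k - 1) (l - 1) + r)
      \<le> (real l + 1) * potential S"
      using block_potential_step[OF \<open>k > 0\<close>, of l] unfolding S S1 by (simp add: algebra_simps)
  qed
qed

section \<open>The expected excess of a run\<close>

lemma intact_remove_mate:
  assumes "intact S" "x \<in> X \<inter> S"
  shows "intact (S - {x, mate x})"
proof -
  \<comment> \<open>By injectivity, the deleted mate belongs to the deleted node \<open>x\<close>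
    and to no surviving block node.\<close>
  have "mate z \<in> S - {x, mate x}" if "z \<in> X \<inter> (S - {x, mate x})" for z
    using that assms inj_onD[OF inj_mate, of z x] X_mate by (auto simp: intact_def)
  moreover have "W \<inter> {x, mate x} = {}" using assms(2) W_X W_mate by auto
  ultimately show ?thesis using assms(1) by (auto simp: intact_def)
qed

lemma intact_remove_opposite:
  assumes "intact S" "x \<in> X \<inter> S" "y \<in> opposite S x"
  shows "intact (S - {x, y})"
  using assms X_mate W_X unfolding intact_def opposite_def by auto

text \<open>The truncated subtraction makes the integrand the positive part of the excess, as needed for
  Markov's inequality; a block edge leaves it unchanged and a mate edge raises it by at most 1.\<close>

lemma excess_min_greedy_le:
  assumes "intact S"
  shows "(\<integral>\<^sup>+M. ennreal (real (2 * card M - card (X \<inter> S))) \<partial>min_greedy (graph S))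
    \<le> ennreal (2 * real (card W) + potential S)"
  using assms
proof (induction "card (X \<inter> S)" arbitrary: S rule: less_induct)
  case less
  have simple: "simple_graph (graph S)"
    using less.prems by (intro simple_graph_graph) (simp add: intact_def)
  show ?case
  proof (cases "X \<inter> S = {}")
    case True
    \<comment> \<open>With no block node left, every edge meets the hub, so at most
      \<open>card W\<close> edges follow.\<close>
    have "e \<inter> W \<noteq> {}" if "e \<in> edges (graph S)" for e
      using that True by (auto simp: graph_def graph_on_def adj_def)
    then have "card M \<le> card W" if "M \<in> set_pmf (min_greedy (graph S))" for M
      using card_min_greedy_le_vertex_cover[OF finite_W] that by blast
    then have "(\<integral>\<^sup>+M. ennreal (real (2 * card M - card (X \<inter> S))) \<partial>min_greedy (graph S))
      \<le> (\<integral>\<^sup>+M. ennreal (2 * real (card W)) \<partial>min_greedy (graph S))"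
      using True by (intro nn_integral_mono_AE) (auto simp: AE_measure_pmf_iff intro!: ennreal_leI)
    also have "\<dots> \<le> ennreal (2 * real (card W) + potential S)"
      using potential_nonneg by (simp add: measure_pmf.emeasure_space_1 ennreal_leI)
    finally show ?thesis .
  next
    case False
    then obtain x where "x \<in> X \<inter> S" by blast
    then have "neighbors (graph S) x \<noteq> {}" using neighbors_X[OF less.prems] by auto
    then have edges: "edges (graph S) \<noteq> {}" by (auto simp: neighbors_def)
    let ?D = "min_degree_nodes (graph S)"
    let ?c = "2 * real (card W)"
    let ?f = "\<lambda>S M. ennreal (real (2 * card M - card (X \<inter> S)))"
    \<comment> \<open>The bound is uniform in \<open>u\<close>, so it does not matter how the
      minimum is distributed over the block nodes.\<close>
    have step: "(\<integral>\<^sup>+v. (\<integral>\<^sup>+M. ?f S (insert {u, v} M)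
        \<partial>min_greedy (graph (S - {u, v}))) \<partial>pmf_of_set (neighbors (graph S) u))
      \<le> ennreal (?c + potential S)" (is "(\<integral>\<^sup>+v. ?I v \<partial>_) \<le> _") if u': "u \<in> X \<inter> S" for u
    proof -
      define l where "l = card (opposite S u)"
      obtain p where p: "1 + potential (S - {u, mate u}) + real l * p \<le> (real l + 1) * potential S"
        and pot: "\<And>y. y \<in> opposite S u \<Longrightarrow> potential (S - {u, y}) = p"
        using potential_step[OF u' l_def] by blast
      \<comment> \<open>Needed to add in \<open>ennreal\<close>. The sign of \<open>p\<close> comes
        from an actual partner; without one, \<open>l = 0\<close>.\<close>
      have "real l * (?c + p) \<ge> 0"
      proof (cases "opposite S u = {}")
        case False
        then have "p \<ge> 0" using pot potential_nonneg by (metis ex_in_conv)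
        then show ?thesis by simp
      qed (simp add: l_def)
      have u: "u \<in> X" using that by auto
      have Xu: "X \<inter> (S - {u, mate u}) = X \<inter> S - {u}" using X_mate u by auto
      then have card1: "card (X \<inter> S) = Suc (card (X \<inter> (S - {u, mate u})))"
        using u' finite_X card.remove[of "X \<inter> S" u] by simp
      \<comment> \<open>A mate edge adds at most 2 to \<open>2 * card M\<close> but removes only one
        block node.\<close>
      have "?I (mate u) \<le> (\<integral>\<^sup>+M. ?f (S - {u, mate u}) M + 1 \<partial>min_greedy (graph (S - {u, mate u})))"
      proof (intro nn_integral_mono)
        fix M
        have "2 * card (insert {u, mate u} M) - card (X \<inter> S)
          \<le> (2 * card M - card (X \<inter> (S - {u, mate u}))) + 1"
          using card_insert_le_Suc[of "{u, mate u}" M] card1 by linarith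
        then have "real (2 * card (insert {u, mate u} M) - card (X \<inter> S))
          \<le> real (2 * card M - card (X \<inter> (S - {u, mate u}))) + 1" by linarith
        then show "?f S (insert {u, mate u} M) \<le> ?f (S - {u, mate u}) M + 1"
          by (simp flip: ennreal_1 ennreal_plus add: ennreal_leI)
      qed
      also have "\<dots> = (\<integral>\<^sup>+M. ?f (S - {u, mate u}) M \<partial>min_greedy (graph (S - {u, mate u}))) + 1"
        by (subst nn_integral_add) (auto simp: measure_pmf.emeasure_space_1)
      also have "\<dots> \<le> ennreal (?c + potential (S - {u, mate u})) + 1"
        using card1 by (intro add_right_mono less.hyps intact_remove_mate[OF less.prems u']) auto
      also have "\<dots> = ennreal (1 + ?c + potential (S - {u, mate u}))"
        using potential_nonneg by (simp flip: ennreal_1 ennreal_plus add: add_ac)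
      finally have I1: "?I (mate u) \<le> ennreal (1 + ?c + potential (S - {u, mate u}))" .
      have I2: "?I y \<le> ennreal (?c + p)" if y: "y \<in> opposite S u" for y
      proof -
        have "y \<noteq> u" "y \<in> X" "y \<in> S" using y by (auto simp: opposite_def)
        moreover have "X \<inter> (S - {u, y}) = X \<inter> S - {u} - {y}" by auto
        ultimately have card2: "card (X \<inter> S) = Suc (Suc (card (X \<inter> (S - {u, y}))))"
          using u' finite_X card.remove[of "X \<inter> S" u] card.remove[of "X \<inter> S - {u}" y] by simp
        \<comment> \<open>A block edge adds at most 2 and removes two block nodes.\<close>
        have "?I y \<le> (\<integral>\<^sup>+M. ?f (S - {u, y}) M \<partial>min_greedy (graph (S - {u, y})))"
        proof (intro nn_integral_mono ennreal_leI)
          fix M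
          have "2 * card (insert {u, y} M) - card (X \<inter> S) \<le> 2 * card M - card (X \<inter> (S - {u, y}))"
            using card_insert_le_Suc[of "{u, y}" M] card2 by linarith
          then show "real (2 * card (insert {u, y} M) - card (X \<inter> S))
            \<le> real (2 * card M - card (X \<inter> (S - {u, y})))" by linarith
        qed
        also have "\<dots> \<le> ennreal (?c + potential (S - {u, y}))"
          using card2 by (intro less.hyps intact_remove_opposite[OF less.prems u' y]) auto
        finally show ?thesis using pot[OF y] by simp
      qed
      have "(\<integral>\<^sup>+v. ?I v \<partial>pmf_of_set (neighbors (graph S) u))
        = (\<Sum>v\<in>insert (mate u) (opposite S u). ?I v) / (real l + 1)"
        unfolding neighbors_X[OF less.prems u'] l_def
        using finite_opposite mate_notin_opposite[OF u]
        by (subst nn_integral_pmf_of_set) (auto simp: add_ac ennreal_of_nat_eq_real_of_nat)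
      also have "\<dots> \<le> ennreal ((real l + 1) * (?c + potential S)) / (real l + 1)"
      proof (intro divide_right_mono_ennreal)
        have "(\<Sum>v\<in>insert (mate u) (opposite S u). ?I v) = ?I (mate u) + (\<Sum>v\<in>opposite S u. ?I v)"
          using finite_opposite mate_notin_opposite[OF u] by (rule sum.insert)
        also have "\<dots> \<le> ennreal (1 + ?c + potential (S - {u, mate u})) + (\<Sum>v\<in>opposite S u. ennreal (?c + p))"
          by (intro add_mono I1 sum_mono I2)
        also have "(\<Sum>v\<in>opposite S u. ennreal (?c + p)) = ennreal (real l * (?c + p))"
          by (cases "l = 0") (auto simp: l_def ennreal_mult' ennreal_of_nat_eq_real_of_nat)
        also have "ennreal (1 + ?c + potential (S - {u, mate u})) + ennreal (real l * (?c + p))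
          = ennreal (1 + ?c + potential (S - {u, mate u}) + real l * (?c + p))"
          using potential_nonneg[of "S - {u, mate u}"] \<open>real l * (?c + p) \<ge> 0\<close>
          by (intro ennreal_plus[symmetric]) auto
        also have "\<dots> \<le> ennreal ((real l + 1) * (?c + potential S))"
          using p by (intro ennreal_leI) (simp add: algebra_simps)
        finally show "(\<Sum>v\<in>insert (mate u) (opposite S u). ?I v)
          \<le> ennreal ((real l + 1) * (?c + potential S))" .
      qed
      also have "\<dots> = ennreal (?c + potential S)"
        using potential_nonneg[of S] by (subst divide_ennreal) auto
      finally show ?thesis .
    qed
    have "(\<integral>\<^sup>+M. ?f S M \<partial>min_greedy (graph S)) = (\<integral>\<^sup>+u. (\<integral>\<^sup>+v. (\<integral>\<^sup>+M. ?f S (insert {u, v} M)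
        \<partial>min_greedy (graph (S - {u, v}))) \<partial>pmf_of_set (neighbors (graph S) u)) \<partial>pmf_of_set ?D)"
      unfolding min_greedy_rec[OF simple edges]
      by (simp only: graph_def delete_nodes_graph_on nn_integral_bind_pmf nn_integral_map_pmf)
    also have "\<dots> \<le> (\<integral>\<^sup>+u. ennreal (?c + potential S) \<partial>pmf_of_set ?D)"
      using min_degree_nodes_in_X[OF less.prems False] finite_min_degree_nodes[OF simple]
        min_degree_nodes_nonempty[OF simple edges]
      by (intro nn_integral_mono_AE) (auto simp: AE_measure_pmf_iff intro!: step)
    also have "\<dots> = ennreal (?c + potential S)"
      by (simp add: measure_pmf.emeasure_space_1)
    finally show ?thesis .
  qed
qed

section \<open>The matching number and Markov's inequality\<close>

lemma card_X_le_matching_number: "card X \<le> matching_number (graph V)"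
proof -
  let ?M = "(\<lambda>x. {x, mate x}) ` X"
  have "{M. matching (graph V) M} \<subseteq> Pow (edges (graph V))" by (auto simp: matching_def)
  then have "finite {M. matching (graph V) M}"
    using simple_graph_finite_edges[OF simple_graph_graph[OF order_refl]]
    by (rule finite_subset[OF _ finite_Pow_iff[THEN iffD2]])
  \<comment> \<open>The mate edges are pairwise disjoint because \<open>mate\<close> is injective
    and maps out of \<open>X\<close>.\<close>
  moreover have "matching (graph V) ?M"
  proof -
    have "?M \<subseteq> edges (graph V)"
      using side_mate by (fastforce simp: graph_def graph_on_def V_def adj_def)
    moreover have "disjoint ?M"
      using X_mate inj_mate by (fastforce simp: disjoint_def dest: inj_onD)
    ultimately show ?thesis by (simp add: matching_def)
  qed
  ultimately have "card ?M \<le> matching_number (graph V)"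
    unfolding matching_number_def by (intro Max_ge) auto
  moreover have "inj_on (\<lambda>x. {x, mate x}) X"
    using X_mate by (auto simp: inj_on_def doubleton_eq_iff)
  ultimately show ?thesis by (simp add: card_image)
qed

text \<open>Since \<open>card X\<close> bounds the matching number from below, a matching that is
  too large has excess at least \<open>2 * \<epsilon> * card X\<close>, while the expected excess is
  at most \<open>2 * card W + potential V\<close>.\<close>

lemma prob_min_greedy_large:
  assumes "X \<noteq> {}" "\<epsilon> > 0"
  shows "measure_pmf.prob (min_greedy (graph V))
      {M. real (card M) \<le> (1/2 + \<epsilon>) * real (matching_number (graph V))}
    \<ge> 1 - (2 * real (card W) + potential V) / (2 * \<epsilon> * real (card X))"
proof -
  let ?p = "min_greedy (graph V)"
  let ?good = "{M. real (card M) \<le> (1/2 + \<epsilon>) * real (matching_number (graph V))}"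
  let ?a = "2 * \<epsilon> * real (card X)"
  let ?f = "\<lambda>M. ennreal (real (2 * card M - card (X \<inter> V)))"
  let ?b = "2 * real (card W) + potential V"
  have a: "?a > 0" using assms finite_X by (simp add: card_gt_0_iff)
  have XV: "X \<inter> V = X" by (auto simp: V_def)
  have "measure_pmf.prob ?p (- ?good) \<le> ?b / ?a"
  proof -
    have "- ?good \<subseteq> {M \<in> space (measure_pmf ?p). 1 \<le> ennreal (1 / ?a) * ?f M}"
    proof
      fix M :: "'a set set" assume "M \<in> - ?good"
      moreover have "(1/2 + \<epsilon>) * real (card X) \<le> (1/2 + \<epsilon>) * real (matching_number (graph V))"
        using card_X_le_matching_number assms by (intro mult_left_mono) auto
      ultimately have "(1/2 + \<epsilon>) * real (card X) < real (card M)" by simp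
      then have "?a \<le> 2 * real (card M) - real (card X)" by (simp add: algebra_simps)
      \<comment> \<open>Positivity of \<open>?a\<close> makes the truncated subtraction agree with
        the real one.\<close>
      then have "?a \<le> real (2 * card M - card X)" using a by linarith
      then have "1 \<le> (1 / ?a) * real (2 * card M - card X)" using a by (simp add: field_simps)
      then have "ennreal 1 \<le> ennreal ((1 / ?a) * real (2 * card M - card X))" by (rule ennreal_leI)
      then show "M \<in> {M \<in> space (measure_pmf ?p). 1 \<le> ennreal (1 / ?a) * ?f M}"
        using a unfolding XV by (subst ennreal_mult[symmetric]) simp_all
    qed
    then have "emeasure ?p (- ?good) \<le> emeasure ?p {M \<in> space (measure_pmf ?p). 1 \<le> ennreal (1 / ?a) * ?f M}"
      by (intro emeasure_mono) auto
    also have "\<dots> \<le> ennreal (1 / ?a) * (\<integral>\<^sup>+M. ?f M \<partial>?p)"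
      using nn_integral_Markov_inequality[of ?f UNIV "measure_pmf ?p" "ennreal (1 / ?a)"] by simp
    also have "\<dots> \<le> ennreal (1 / ?a) * ennreal ?b"
      by (intro mult_left_mono excess_min_greedy_le intact_V) auto
    also have "\<dots> = ennreal (?b / ?a)"
      using a potential_nonneg by (subst ennreal_mult[symmetric]) auto
    finally show ?thesis
      using a potential_nonneg[of V] by (simp add: measure_pmf.emeasure_eq_measure)
  qed
  then show ?thesis using measure_pmf.prob_compl[of ?good ?p] by (simp add: Compl_eq_Diff_UNIV)
qed

end

section \<open>An instance on the natural numbers and the limit\<close>

lemma card_parity_interval:
  "card {x :: nat. 2 * a \<le> x \<and> x < 2 * a + 2 * k \<and> even x = s} = k"
proof -
  have "{x :: nat. 2 * a \<le> x \<and> x < 2 * a + 2 * k \<and> even x = s}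
    = (\<lambda>i. 2 * (a + i) + of_bool (\<not> s)) ` {..<k}" (is "?A = ?f ` _")
  proof (intro equalityI subsetI)
    fix x assume x: "x \<in> ?A"
    then have "x = ?f (x div 2 - a)" by (cases s) (auto elim!: evenE oddE)
    moreover have "x div 2 - a \<in> {..<k}" using x by auto
    ultimately show "x \<in> ?f ` {..<k}" by blast
  next
    fix x assume "x \<in> ?f ` {..<k}"
    then show "x \<in> ?A" by (cases s) auto
  qed
  moreover have "inj_on ?f {..<k}" by (auto simp: inj_on_def)
  ultimately show ?thesis by (simp add: card_image)
qed

text \<open>Blocks are runs of \<open>2 * n\<close> consecutive numbers, sides are parities, and
  mates arise by reflecting the lower half of the first \<open>4 * n * n\<close> numbers onto the
  upper half. The hub comes after them.\<close>

lemma block_graph_nat: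
  fixes n :: nat
  assumes "n > 0"
  shows "block_graph {..<2 * n * n} {4 * n * n..<4 * n * n + 2 * (n + 2)} {..<n}
    (\<lambda>x. x div (2 * n)) even (\<lambda>x. 4 * n * n - 1 - x) n"
proof
  show "(\<lambda>x. x div (2 * n)) ` {..<2 * n * n} \<subseteq> {..<n}"
    by (auto simp: div_less_iff_less_mult assms mult_ac)
next
  fix b s assume b: "b \<in> {..<n}"
  have "2 * n * Suc b \<le> 2 * n * n" using b by (intro mult_left_mono) auto
  then have le: "2 * (n * b) + 2 * n \<le> 2 * n * n" by (simp add: algebra_simps)
  have "x div (2 * n) = b \<longleftrightarrow> 2 * (n * b) \<le> x \<and> x < 2 * (n * b) + 2 * n" for x
  proof -
    have "x div (2 * n) = b \<longleftrightarrow> b \<le> x div (2 * n) \<and> x div (2 * n) < Suc b" by auto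
    then show ?thesis
      using assms by (simp add: less_eq_div_iff_mult_less_eq div_less_iff_less_mult algebra_simps)
  qed
  then have "{x \<in> {..<2 * n * n}. x div (2 * n) = b \<and> even x = s}
    = {x. x < 2 * n * n \<and> 2 * (n * b) \<le> x \<and> x < 2 * (n * b) + 2 * n \<and> even x = s}"
    by simp
  also have "\<dots> = {x. 2 * (n * b) \<le> x \<and> x < 2 * (n * b) + 2 * n \<and> even x = s}"
    using le by (intro Collect_cong) linarith
  finally have "{x \<in> {..<2 * n * n}. x div (2 * n) = b \<and> even x = s}
    = {x. 2 * (n * b) \<le> x \<and> x < 2 * (n * b) + 2 * n \<and> even x = s}" .
  then show "card {x \<in> {..<2 * n * n}. x div (2 * n) = b \<and> even x = s} = n"
    by (simp only: card_parity_interval)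
next
  fix s
  show "card {w \<in> {4 * n * n..<4 * n * n + 2 * (n + 2)}. even w = s} = n + 2"
    using card_parity_interval[of "2 * n * n" "n + 2" s] by (simp add: conj_assoc mult.assoc)
next
  show "inj_on (\<lambda>x. 4 * n * n - 1 - x) {..<2 * n * n}" by (rule inj_onI) auto
next
  fix x assume "x \<in> {..<2 * n * n}"
  \<comment> \<open>A node and its mate sum to the odd number \<open>4 * n * n - 1\<close>, so their
    parities differ.\<close>
  then have "Suc (4 * n * n - 1 - x + x) = 2 * (2 * n * n)" by auto
  then have "odd (4 * n * n - 1 - x + x)" by (metis dvd_triv_left even_Suc)
  then show "even (4 * n * n - 1 - x) \<noteq> even x" unfolding even_add by blast
next
  show "{..<2 * n * n} \<inter> (\<lambda>x. 4 * n * n - 1 - x) ` {..<2 * n * n} = {}" by auto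
next
  show "{4 * n * n..<4 * n * n + 2 * (n + 2)} \<inter> {..<2 * n * n} = {}" by auto
next
  show "{4 * n * n..<4 * n * n + 2 * (n + 2)} \<inter> (\<lambda>x. 4 * n * n - 1 - x) ` {..<2 * n * n} = {}"
    by auto
qed simp_all

text \<open>The Markov quotient for \<open>2 * (n + 2)\<close> hub nodes, \<open>n\<close> blocks
  and \<open>2 * n * n\<close> block nodes: order \<open>n * ln n\<close> over order
  \<open>n * n\<close>.\<close>

definition failure_bound :: "real \<Rightarrow> nat \<Rightarrow> real" where
  "failure_bound \<epsilon> n =
    (4 * (real n + 2) + real n * (2 * ln (real n + 1))) / (2 * \<epsilon> * (2 * real n * real n))"

lemma exists_hard_graph:
  assumes "n > 0" "\<epsilon> > 0"
  shows "\<exists>G :: nat graph. simple_graph G \<and> bipartite G \<and> edges G \<noteq> {} \<and>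
    1 - failure_bound \<epsilon> n \<le> measure_pmf.prob (min_greedy G)
      {M. real (card M) \<le> (1/2 + \<epsilon>) * real (matching_number G)}"
proof -
  interpret block_graph "{..<2 * n * n}" "{4 * n * n..<4 * n * n + 2 * (n + 2)}" "{..<n}"
    "\<lambda>x. x div (2 * n)" even "\<lambda>x. 4 * n * n - 1 - x" n
    by (rule block_graph_nat) fact
  define G where "G = graph V"
  have X: "0 \<in> {..<2 * n * n} \<inter> V" using assms(1) X_subset_V by auto
  have "edges G \<noteq> {}"
    using neighbors_X[OF intact_V X] by (auto simp: neighbors_def G_def)
  moreover have "simple_graph G" "bipartite G"
    using simple_graph_graph[OF order_refl] bipartite_graph by (simp_all add: G_def)
  moreover have "(2 * real (card {4 * n * n..<4 * n * n + 2 * (n + 2)}) + potential V) /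
      (2 * \<epsilon> * real (card {..<2 * n * n})) = failure_bound \<epsilon> n"
    unfolding potential_V failure_bound_def by simp
  moreover have "{..<2 * n * n} \<noteq> {}" using X by blast
  note prob_min_greedy_large[OF this assms(2), folded G_def]
  ultimately show ?thesis by metis
qed

lemma failure_bound_tendsto:
  assumes "\<epsilon> > 0"
  shows "failure_bound \<epsilon> \<longlonglongrightarrow> 0"
  unfolding failure_bound_def using assms by real_asymp

theorem theorem1:
  fixes \<epsilon> :: real
  assumes "\<epsilon> > 0"
  shows "\<exists>G :: nat \<Rightarrow> nat graph.
    (\<forall>n. simple_graph (G n) \<and> bipartite (G n) \<and> edges (G n) \<noteq> {}) \<and>
    (\<lambda>n. measure_pmf.prob (min_greedy (G n))
           {M. real (card M) \<le> (1/2 + \<epsilon>) * real (matching_number (G n))}) \<longlonglongrightarrow> 1"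
proof -
  \<comment> \<open>The shift to \<open>Suc n\<close> supplies a nonempty graph at index 0 as
    well.\<close>
  have "\<forall>n. \<exists>G :: nat graph. simple_graph G \<and> bipartite G \<and> edges G \<noteq> {} \<and>
    1 - failure_bound \<epsilon> (Suc n) \<le> measure_pmf.prob (min_greedy G)
      {M. real (card M) \<le> (1/2 + \<epsilon>) * real (matching_number G)}"
    using exists_hard_graph assms by blast
  then obtain G :: "nat \<Rightarrow> nat graph" where
    G: "\<And>n. simple_graph (G n) \<and> bipartite (G n) \<and> edges (G n) \<noteq> {}" and
    prob: "\<And>n. 1 - failure_bound \<epsilon> (Suc n) \<le> measure_pmf.prob (min_greedy (G n))
      {M. real (card M) \<le> (1/2 + \<epsilon>) * real (matching_number (G n))}"
    by metis
  have "(\<lambda>n. failure_bound \<epsilon> (Suc n)) \<longlonglongrightarrow> 0"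
    using failure_bound_tendsto[OF assms] by (rule LIMSEQ_Suc)
  from tendsto_diff[OF tendsto_const this, of 1]
  have lower: "(\<lambda>n. 1 - failure_bound \<epsilon> (Suc n)) \<longlonglongrightarrow> 1" by simp
  have "(\<lambda>n. measure_pmf.prob (min_greedy (G n))
    {M. real (card M) \<le> (1/2 + \<epsilon>) * real (matching_number (G n))}) \<longlonglongrightarrow> 1"
    by (rule tendsto_sandwich[OF _ _ lower tendsto_const])
       (simp_all add: prob measure_pmf.prob_le_1)
  with G show ?thesis by blast
qed

end
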